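(* Consider the two ternary Leibniz algebras over $\mathbb{C}$ with basis $\{e_1,e_2\}$ (brackets of basis vectors not listed are zero): $\mathcal{L}_1$: $[e_1,e_1,e_1]=e_2$; and $\mathcal{L}_2$: $[e_1,e_2,e_2]=e_1,\ [e_2,e_2,e_2]=e_1$. The averaging operators $\vartheta$ on these algebras are described as follows (with $\vartheta_{ij}\in\mathbb{C}$ arbitrary parameters). \begin{itemize} \item The averaging operators on $\mathcal{L}_1$ are exactly the linear maps whose matrix has one of the forms $$\begin{pmatrix}\vartheta_{11}&0\\ \vartheta_{21}&\vartheta_{11}\end{pmatrix},\qquad \begin{pmatrix}0&0\\ \vartheta_{21}&\vartheta_{22}\end{pmatrix}.$$ \item The averaging operators on $\mathcal{L}_2$ are exactly the linear maps whose matrix has one of the forms $$\begin{pmatrix}\vartheta_{11}&0\\ 0&\vartheta_{11}\end{pmatrix},\qquad \begin{pmatrix}\vartheta_{11}&\vartheta_{12}\\ 0&0\end{pmatrix},\qquad \begin{pmatrix}0&\vartheta_{12}\\ 0&-\vartheta_{12}\end{pmatrix}.$$ \end{itemize}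
   Context: A ternary Leibniz algebra is a vector space $L$ with a trilinear bracket satisfying $[[x,y,z],t,u]=[x,y,[z,t,u]]+[x,[y,t,u],z]+[[x,t,u],y,z]$ for all $x,y,z,t,u\in L$. An averaging operator on it is a linear map $\beta:L\to L$ with, for all $x,y,z\in L$, $$\beta([\beta(x),\beta(y),z])=\beta([\beta(x),y,\beta(z)])=\beta([x,\beta(y),\beta(z)])=[\beta(x),\beta(y),\beta(z)].$$ The matrix $(\vartheta_{ij})$ of a linear map $\vartheta$ in the basis $\{e_i\}$ is defined by $\vartheta(e_i)=\sum_j\vartheta_{ji}e_j$ (columns are the images of basis vectors). *)

theory Defs
  imports "HOL-Analysis.Cartesian_Space"
begin

definition trilinear ::
    "('k::field \<Rightarrow> 'v::ab_group_add \<Rightarrow> 'v) \<Rightarrow> ('v \<Rightarrow> 'v \<Rightarrow> 'v \<Rightarrow> 'v) \<Rightarrow> bool" where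
  "trilinear smul br \<longleftrightarrow>
     (\<forall>y z. Vector_Spaces.linear smul smul (\<lambda>x. br x y z)) \<and>
     (\<forall>x z. Vector_Spaces.linear smul smul (\<lambda>y. br x y z)) \<and>
     (\<forall>x y. Vector_Spaces.linear smul smul (\<lambda>z. br x y z))"

locale ternary_leibniz_algebra = vector_space smul
  for smul :: "'k::field \<Rightarrow> 'v::ab_group_add \<Rightarrow> 'v" +
  fixes br :: "'v \<Rightarrow> 'v \<Rightarrow> 'v \<Rightarrow> 'v"
  assumes trilinear_br: "trilinear smul br"
    and leibniz:
      "br (br x y z) t u = br x y (br z t u) + br x (br y t u) z + br (br x t u) y z"

definition averaging_operator ::
    "('k::field \<Rightarrow> 'v::ab_group_add \<Rightarrow> 'v) \<Rightarrow> ('v \<Rightarrow> 'v \<Rightarrow> 'v \<Rightarrow> 'v) \<Rightarrow> ('v \<Rightarrow> 'v) \<Rightarrow> bool" where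
  "averaging_operator smul br \<beta> \<longleftrightarrow>
     Vector_Spaces.linear smul smul \<beta> \<and>
     (\<forall>x y z. \<beta> (br (\<beta> x) (\<beta> y) z) = br (\<beta> x) (\<beta> y) (\<beta> z) \<and>
              \<beta> (br (\<beta> x) y (\<beta> z)) = br (\<beta> x) (\<beta> y) (\<beta> z) \<and>
              \<beta> (br x (\<beta> y) (\<beta> z)) = br (\<beta> x) (\<beta> y) (\<beta> z))"

definition basis_family ::
    "('k::field \<Rightarrow> 'v::ab_group_add \<Rightarrow> 'v) \<Rightarrow> ('n \<Rightarrow> 'v) \<Rightarrow> bool" where
  "basis_family smul e \<longleftrightarrow>
     inj e \<and> \<not> module.dependent smul (range e) \<and> module.span smul (range e) = UNIV"

text \<open>
  Matrices are lists of rows, so \<open>A $ j $ i\<close> is the entry in row \<open>j\<close> and column \<open>i\<close>;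
  the columns of \<open>A\<close> are the coordinates of the images of the basis vectors.
\<close>

definition has_matrix ::
    "('k::field \<Rightarrow> 'v::ab_group_add \<Rightarrow> 'v) \<Rightarrow> ('n::finite \<Rightarrow> 'v) \<Rightarrow> ('v \<Rightarrow> 'v) \<Rightarrow> 'k^'n^'n \<Rightarrow> bool" where
  "has_matrix smul e \<theta> A \<longleftrightarrow> (\<forall>i. \<theta> (e i) = (\<Sum>j\<in>UNIV. smul (A $ j $ i) (e j)))"

end

theory Submission
  imports Defs
begin

text \<open>
  Both brackets take values in a line, and each is that line's generator times a product of three
  linear forms: with \<open>x = x\<^sub>1 e\<^sub>1 + x\<^sub>2 e\<^sub>2\<close> etc., trilinearity gives
  \<open>[x,y,z] = x\<^sub>1 y\<^sub>1 z\<^sub>1 e\<^sub>2\<close> in the first algebra and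
  \<open>[x,y,z] = (x\<^sub>1 + x\<^sub>2) y\<^sub>2 z\<^sub>2 e\<^sub>1\<close> in the second. The Leibniz identity is then immediate.
  In the first algebra the bracket vanishes when \<open>e\<^sub>2\<close> stands in any slot, so all four terms are zero;
  in the second it vanishes when \<open>e\<^sub>1\<close> stands in one of the last two slots, and the first slot only sees
  \<open>x\<^sub>1 + x\<^sub>2\<close>, which is \<open>1\<close> on \<open>e\<^sub>1\<close>, so the left-hand side and the last term on the right both equal
  \<open>(x\<^sub>1 + x\<^sub>2) y\<^sub>2 z\<^sub>2 t\<^sub>2 u\<^sub>2 e\<^sub>1\<close>.

  Let \<open>\<theta> e\<^sub>1 = a e\<^sub>1 + c e\<^sub>2\<close> and \<open>\<theta> e\<^sub>2 = b e\<^sub>1 + d e\<^sub>2\<close>. In both algebras the right-hand side of the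
  averaging condition lies on the line of the bracket, so \<open>\<theta>\<close> must preserve that line as soon as the
  inner bracket can be made nonzero. Testing on the right basis vectors, this yields \<open>b\<^sup>3 = 0\<close> for the
  first algebra and \<open>c\<^sup>3 = 0\<close> for the second. Then only scalar equations remain:
  \<open>a\<^sup>2 d = a\<^sup>3\<close> in the first case; \<open>a d (a - d) = 0\<close> and \<open>d\<^sup>2 (a - b - d) = 0\<close> in the second. Their
  solutions are the listed matrix shapes (lemmas \<open>averaging_cube_iff\<close> and \<open>averaging_sum_square_iff\<close>), and
  conversely each solution satisfies the averaging identities for all arguments, because these are
  polynomial identities in the coordinates.
\<close>

section \<open>Coordinates with respect to a two-element basis\<close>

locale two_dim_space = vector_space smul
  for smul :: "'k::field \<Rightarrow> 'v::ab_group_add \<Rightarrow> 'v" +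
  fixes e :: "2 \<Rightarrow> 'v"
  assumes basis: "basis_family smul e"
begin

definition pt :: "'k \<Rightarrow> 'k \<Rightarrow> 'v" where
  "pt x y = smul x (e 1) + smul y (e 2)"

lemma pt_add: "pt x y + pt x' y' = pt (x + x') (y + y')"
  by (simp add: pt_def scale_left_distrib algebra_simps)

lemma scale_pt: "smul r (pt x y) = pt (r * x) (r * y)"
  by (simp add: pt_def scale_right_distrib)

lemma pt_zero: "pt 0 0 = 0"
  by (simp add: pt_def)

lemma basis_eq_pt: "e 1 = pt 1 0" "e 2 = pt 0 1"
  by (simp_all add: pt_def)

lemma range_basis: "range e = {e 1, e 2}"
  by (auto simp: UNIV_2)

lemma basis_distinct: "e 1 \<noteq> e 2"
proof
  assume "e 1 = e 2"
  then have "(1::2) = 2"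
    using basis by (auto simp: basis_family_def dest: injD)
  then show False by simp
qed

lemma pt_eq_zero_iff: "pt x y = 0 \<longleftrightarrow> x = 0 \<and> y = 0"
proof
  assume eq: "pt x y = 0"
  have indep: "independent {e 1, e 2}"
    using basis by (simp add: basis_family_def range_basis)
  let ?c = "\<lambda>v. if v = e 1 then x else y"
  have "(\<Sum>v\<in>{e 1, e 2}. smul (?c v) v) = 0"
    using eq basis_distinct by (simp add: pt_def)
  then have "?c v = 0" if "v \<in> {e 1, e 2}" for v
    using independentD[OF indep, of "{e 1, e 2}" ?c v] that by simp
  from this[of "e 1"] this[of "e 2"] show "x = 0 \<and> y = 0"
    using basis_distinct by simp
qed (simp add: pt_zero)

lemma pt_inject: "pt x y = pt x' y' \<longleftrightarrow> x = x' \<and> y = y'"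
proof -
  have "pt x y = pt x' y' \<longleftrightarrow> pt (x - x') (y - y') = 0"
    by (simp add: pt_def scale_left_diff_distrib algebra_simps)
  then show ?thesis
    by (simp add: pt_eq_zero_iff)
qed

lemma pt_cases: obtains x y where "v = pt x y"
proof -
  have "v \<in> span {e 1, e 2}"
    using basis by (simp add: basis_family_def range_basis)
  then obtain x y where "v - smul x (e 1) = smul y (e 2)"
    by (auto simp: span_insert span_singleton)
  then have "v = pt x y"
    by (simp add: pt_def algebra_simps)
  then show thesis by (rule that)
qed

lemma all_pt: "(\<forall>v. P v) \<longleftrightarrow> (\<forall>x y. P (pt x y))"
  by (metis pt_cases)

lemma linear_pt:
  assumes "Vector_Spaces.linear smul smul \<theta>"
  shows "\<theta> (pt x y) = smul x (\<theta> (e 1)) + smul y (\<theta> (e 2))"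
proof -
  interpret \<theta>: Vector_Spaces.linear smul smul \<theta> by fact
  show ?thesis by (simp add: pt_def \<theta>.add \<theta>.scale)
qed

lemma has_matrix_iff:
  "has_matrix smul e \<theta> (vector [vector [a, b], vector [c, d]]) \<longleftrightarrow>
     \<theta> (e 1) = pt a c \<and> \<theta> (e 2) = pt b d"
  by (simp add: has_matrix_def forall_2 sum_2 vector_2 pt_def)

lemma trilinear_pt:
  assumes "trilinear smul br"
  shows "br (pt x x') (pt y y') (pt z z') =
    smul (x * y * z) (br (e 1) (e 1) (e 1)) + smul (x * y * z') (br (e 1) (e 1) (e 2)) +
    smul (x * y' * z) (br (e 1) (e 2) (e 1)) + smul (x * y' * z') (br (e 1) (e 2) (e 2)) +
    smul (x' * y * z) (br (e 2) (e 1) (e 1)) + smul (x' * y * z') (br (e 2) (e 1) (e 2)) +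
    smul (x' * y' * z) (br (e 2) (e 2) (e 1)) + smul (x' * y' * z') (br (e 2) (e 2) (e 2))"
proof -
  have lin: "Vector_Spaces.linear smul smul (\<lambda>u. br u v w)"
    "Vector_Spaces.linear smul smul (\<lambda>u. br v u w)"
    "Vector_Spaces.linear smul smul (\<lambda>u. br v w u)" for v w
    using assms by (auto simp: trilinear_def)
  show ?thesis
    by (simp add: linear_pt[OF lin(1)] linear_pt[OF lin(2)] linear_pt[OF lin(3)]
        scale_right_distrib add_ac mult_ac)
qed

section \<open>The algebra with only nonzero product \<open>[e\<^sub>1,e\<^sub>1,e\<^sub>1] = e\<^sub>2\<close>\<close>

lemma cube_bracket:
  assumes "trilinear smul br"
    and "\<And>i j k. br (e i) (e j) (e k) = (if (i, j, k) = (1, 1, 1) then e 2 else 0)"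
  shows "br (pt x x') (pt y y') (pt z z') = pt 0 (x * y * z)"
  by (simp add: trilinear_pt[OF assms(1)] assms(2)) (simp add: pt_def)

lemma cube_leibniz:
  assumes "trilinear smul br"
    and "\<And>x x' y y' z z'. br (pt x x') (pt y y') (pt z z') = pt 0 (x * y * z)"
  shows "ternary_leibniz_algebra smul br"
proof
  show "trilinear smul br" by fact
  show "br (br x y z) t u = br x y (br z t u) + br x (br y t u) z + br (br x t u) y z"
    for x y z t u
    by (rule pt_cases[of x], rule pt_cases[of y], rule pt_cases[of z],
        rule pt_cases[of t], rule pt_cases[of u]) (simp add: assms(2) pt_zero)
qed

lemma averaging_cube_iff:
  assumes br: "\<And>x x' y y' z z'. br (pt x x') (pt y y') (pt z z') = pt 0 (x * y * z)"
    and lin: "Vector_Spaces.linear smul smul \<theta>"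
    and \<theta>: "\<theta> (e 1) = pt a c" "\<theta> (e 2) = pt b d"
  shows "averaging_operator smul br \<theta> \<longleftrightarrow> b = 0 \<and> (a = 0 \<or> d = a)"
proof -
  have \<theta>_pt: "\<theta> (pt x y) = pt (x * a + y * b) (x * c + y * d)" for x y
    by (simp add: linear_pt[OF lin] \<theta> scale_pt pt_add)
  show ?thesis
  proof
    assume "averaging_operator smul br \<theta>"
    then have avg: "\<theta> (br (\<theta> x) (\<theta> y) z) = br (\<theta> x) (\<theta> y) (\<theta> z)" for x y z
      by (simp add: averaging_operator_def)
    \<comment> \<open>at \<open>(e\<^sub>2, e\<^sub>2, e\<^sub>1)\<close> the inner bracket is \<open>b\<^sup>2 e\<^sub>2\<close>, so the \<open>e\<^sub>1\<close>-coordinate reads \<open>b\<^sup>3 = 0\<close>\<close>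
    have "b = 0"
      using avg[of "pt 0 1" "pt 0 1" "pt 1 0"] by (simp add: \<theta>_pt br pt_inject)
    moreover have "a = 0 \<or> d = a"
      using avg[of "pt 1 0" "pt 1 0" "pt 1 0"] by (auto simp: \<theta>_pt br pt_inject)
    ultimately show "b = 0 \<and> (a = 0 \<or> d = a)" ..
  next
    assume "b = 0 \<and> (a = 0 \<or> d = a)"
    then show "averaging_operator smul br \<theta>"
      using lin by (auto simp: averaging_operator_def all_pt \<theta>_pt br pt_inject)
  qed
qed

section \<open>The algebra with nonzero products \<open>[e\<^sub>1,e\<^sub>2,e\<^sub>2] = [e\<^sub>2,e\<^sub>2,e\<^sub>2] = e\<^sub>1\<close>\<close>

lemma sum_square_bracket:
  assumes "trilinear smul br"
    and "\<And>i j k. br (e i) (e j) (e k) =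
           (if (i, j, k) = (1, 2, 2) then e 1 else if (i, j, k) = (2, 2, 2) then e 1 else 0)"
  shows "br (pt x x') (pt y y') (pt z z') = pt ((x + x') * y' * z') 0"
  by (simp add: trilinear_pt[OF assms(1)] assms(2))
    (simp add: pt_def scale_left_distrib distrib_right)

lemma sum_square_leibniz:
  assumes "trilinear smul br"
    and "\<And>x x' y y' z z'. br (pt x x') (pt y y') (pt z z') = pt ((x + x') * y' * z') 0"
  shows "ternary_leibniz_algebra smul br"
proof
  show "trilinear smul br" by fact
  show "br (br x y z) t u = br x y (br z t u) + br x (br y t u) z + br (br x t u) y z"
    for x y z t u
    by (rule pt_cases[of x], rule pt_cases[of y], rule pt_cases[of z],
        rule pt_cases[of t], rule pt_cases[of u])
      (simp add: assms(2) pt_add pt_inject mult_ac)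
qed

text \<open>
  The averaging condition with the free argument in the first slot forces \<open>\<theta>\<close> to preserve the
  line of \<open>e\<^sub>1\<close> and, for \<open>d \<noteq> 0\<close>, to multiply the form \<open>x\<^sub>1 + x\<^sub>2\<close> by \<open>a\<close>; the condition with the
  free argument in the last slot then leaves \<open>a = d\<close> or \<open>a = 0\<close>.
\<close>

lemma averaging_sum_square_iff:
  assumes br: "\<And>x x' y y' z z'. br (pt x x') (pt y y') (pt z z') = pt ((x + x') * y' * z') 0"
    and lin: "Vector_Spaces.linear smul smul \<theta>"
    and \<theta>: "\<theta> (e 1) = pt a c" "\<theta> (e 2) = pt b d"
  shows "averaging_operator smul br \<theta> \<longleftrightarrow>
    c = 0 \<and> (b = 0 \<and> a = d \<or> d = 0 \<or> a = 0 \<and> d = - b)"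
proof -
  have \<theta>_pt: "\<theta> (pt x y) = pt (x * a + y * b) (x * c + y * d)" for x y
    by (simp add: linear_pt[OF lin] \<theta> scale_pt pt_add)
  show ?thesis
  proof
    assume "averaging_operator smul br \<theta>"
    then have last: "\<theta> (br (\<theta> x) (\<theta> y) z) = br (\<theta> x) (\<theta> y) (\<theta> z)"
      and first: "\<theta> (br x (\<theta> y) (\<theta> z)) = br (\<theta> x) (\<theta> y) (\<theta> z)" for x y z
      by (simp_all add: averaging_operator_def)
    \<comment> \<open>here the inner bracket is \<open>c\<^sup>2 e\<^sub>1\<close>, so the \<open>e\<^sub>2\<close>-coordinate reads \<open>c\<^sup>3 = 0\<close>\<close>
    have c: "c = 0"
      using first[of "pt 1 0" "pt 1 0" "pt 1 0"] by (simp add: \<theta>_pt br pt_inject)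
    have "d = 0 \<or> a = b + d"
      using first[of "pt 0 1" "pt 0 1" "pt 0 1"] by (auto simp: \<theta>_pt br pt_inject c)
    moreover have "a = 0 \<or> d = 0 \<or> a = d"
      using last[of "pt 1 0" "pt 0 1" "pt 0 1"] by (auto simp: \<theta>_pt br pt_inject c)
    ultimately show "c = 0 \<and> (b = 0 \<and> a = d \<or> d = 0 \<or> a = 0 \<and> d = - b)"
      using c by (auto simp: eq_neg_iff_add_eq_0 add.commute)
  next
    assume "c = 0 \<and> (b = 0 \<and> a = d \<or> d = 0 \<or> a = 0 \<and> d = - b)"
    then show "averaging_operator smul br \<theta>"
      using lin by (auto simp: averaging_operator_def all_pt \<theta>_pt br pt_inject algebra_simps)
  qed
qed

end

section \<open>The classification\<close>

theorem proposition4p5: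
  fixes smul :: "complex \<Rightarrow> 'v::ab_group_add \<Rightarrow> 'v"
    and e :: "2 \<Rightarrow> 'v"
    and br1 br2 :: "'v \<Rightarrow> 'v \<Rightarrow> 'v \<Rightarrow> 'v"
  assumes "vector_space smul"
    and "basis_family smul e"
    and "trilinear smul br1"
    and "\<And>i j k. br1 (e i) (e j) (e k) =
           (if (i, j, k) = (1, 1, 1) then e 2 else 0)"
    and "trilinear smul br2"
    and "\<And>i j k. br2 (e i) (e j) (e k) =
           (if (i, j, k) = (1, 2, 2) then e 1
            else if (i, j, k) = (2, 2, 2) then e 1 else 0)"
  shows "ternary_leibniz_algebra smul br1 \<and>
    ternary_leibniz_algebra smul br2 \<and>
    {\<theta>. averaging_operator smul br1 \<theta>} =
      {\<theta>. Vector_Spaces.linear smul smul \<theta> \<and>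
         ((\<exists>t11 t21. has_matrix smul e \<theta> (vector [vector [t11, 0],
                                                 vector [t21, t11]])) \<or>
          (\<exists>t21 t22. has_matrix smul e \<theta> (vector [vector [0, 0],
                                                 vector [t21, t22]])))} \<and>
    {\<theta>. averaging_operator smul br2 \<theta>} =
      {\<theta>. Vector_Spaces.linear smul smul \<theta> \<and>
         ((\<exists>t11. has_matrix smul e \<theta> (vector [vector [t11, 0],
                                             vector [0, t11]])) \<or>
          (\<exists>t11 t12. has_matrix smul e \<theta> (vector [vector [t11, t12],
                                                 vector [0, 0]])) \<or>
          (\<exists>t12. has_matrix smul e \<theta> (vector [vector [0, t12],
                                             vector [0, - t12]])))}"
proof -
  interpret two_dim_space smul e
    using assms(1,2) by (simp add: two_dim_space_def two_dim_space_axioms_def)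
  note br1 = cube_bracket[OF assms(3,4)]
  note br2 = sum_square_bracket[OF assms(5,6)]
  have L1: "averaging_operator smul br1 \<theta> \<longleftrightarrow>
      Vector_Spaces.linear smul smul \<theta> \<and>
      ((\<exists>t11 t21. has_matrix smul e \<theta> (vector [vector [t11, 0], vector [t21, t11]])) \<or>
       (\<exists>t21 t22. has_matrix smul e \<theta> (vector [vector [0, 0], vector [t21, t22]])))" for \<theta>
  proof (cases "Vector_Spaces.linear smul smul \<theta>")
    case True
    obtain a c where 1: "\<theta> (e 1) = pt a c" by (rule pt_cases)
    obtain b d where 2: "\<theta> (e 2) = pt b d" by (rule pt_cases)
    show ?thesis
      unfolding averaging_cube_iff[OF br1 True 1 2] has_matrix_iff 1 2 pt_inject
      using True by auto
  qed (simp add: averaging_operator_def)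
  have L2: "averaging_operator smul br2 \<theta> \<longleftrightarrow>
      Vector_Spaces.linear smul smul \<theta> \<and>
      ((\<exists>t11. has_matrix smul e \<theta> (vector [vector [t11, 0], vector [0, t11]])) \<or>
       (\<exists>t11 t12. has_matrix smul e \<theta> (vector [vector [t11, t12], vector [0, 0]])) \<or>
       (\<exists>t12. has_matrix smul e \<theta> (vector [vector [0, t12], vector [0, - t12]])))" for \<theta>
  proof (cases "Vector_Spaces.linear smul smul \<theta>")
    case True
    obtain a c where 1: "\<theta> (e 1) = pt a c" by (rule pt_cases)
    obtain b d where 2: "\<theta> (e 2) = pt b d" by (rule pt_cases)
    show ?thesis
      unfolding averaging_sum_square_iff[OF br2 True 1 2] has_matrix_iff 1 2 pt_inject
      using True by auto
  qed (simp add: averaging_operator_def)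
  show ?thesis
    using cube_leibniz[OF assms(3) br1] sum_square_leibniz[OF assms(5) br2] L1 L2 by blast
qed

end
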